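(* Let $Br(E_8)$ be the generalized braid group (Artin group) of type $E_8$, with canonical generators $\sigma_1,\dots,\sigma_7,\omega$. Put $\sigma=\sigma_1\sigma_2\cdots\sigma_7$. Then $Br(E_8)$ has a presentation with three generators $\sigma_1,\sigma,\omega$ and relations $$\begin{cases} \sigma_1\sigma^i\sigma_1\sigma^{-i}=\sigma^i\sigma_1\sigma^{-i}\sigma_1 & \text{for } i=2,3,4,\\ \sigma^8=(\sigma\sigma_1)^7,\\ \omega\sigma^i\sigma_1\sigma^{-i}=\sigma^i\sigma_1\sigma^{-i}\omega & \text{for } i=0,1,3,4,5,6,\\ \omega\sigma^2\sigma_1\sigma^{-2}\omega=\sigma^2\sigma_1\sigma^{-2}\omega\sigma^2\sigma_1\sigma^{-2}. \end{cases}$$ Moreover, adding the relations $\sigma_1^2=1$ and $\omega^2=1$ to these gives a presentation of the Coxeter group of type $E_8$.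
   Context: The braid group of type $E_8$ is the Artin group of the $E_8$ Coxeter graph, with nodes labelled so that $\sigma_1,\dots,\sigma_7$ form, in this order, a linear chain and $\omega$ is joined only to $\sigma_3$. Explicitly, it has generators $\sigma_1,\dots,\sigma_7,\omega$ and relations: $\sigma_i\sigma_j=\sigma_j\sigma_i$ if $|i-j|>1$; $\sigma_i\sigma_{i+1}\sigma_i=\sigma_{i+1}\sigma_i\sigma_{i+1}$ for $1\le i\le 6$; $\omega\sigma_i=\sigma_i\omega$ for $i\ne 3$; $\omega\sigma_3\omega=\sigma_3\omega\sigma_3$. The Coxeter group of type $E_8$ is its quotient by the additional relations that the squares of all canonical generators $\sigma_1,\dots,\sigma_7,\omega$ are trivial. *)

theory Defs
  imports "HOL-Algebra.Coset"
begin

section \<open>Free groups\<close>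

text \<open>A letter \<open>(x, True)\<close> stands for \<open>x\<close> and \<open>(x, False)\<close> for its formal inverse.\<close>

type_synonym 'a word = "('a \<times> bool) list"

definition words :: "'a set \<Rightarrow> 'a word set"
  where "words X = lists (X \<times> UNIV)"

inductive_set free_rel :: "'a set \<Rightarrow> ('a word \<times> 'a word) set" for X :: "'a set"
  where
    cancel: "u \<in> words X \<Longrightarrow> v \<in> words X \<Longrightarrow> x \<in> X \<Longrightarrow>
      (u @ [(x, b), (x, \<not> b)] @ v, u @ v) \<in> free_rel X"
  | refl: "u \<in> words X \<Longrightarrow> (u, u) \<in> free_rel X"
  | sym: "(u, v) \<in> free_rel X \<Longrightarrow> (v, u) \<in> free_rel X"
  | trans: "(u, v) \<in> free_rel X \<Longrightarrow> (v, w) \<in> free_rel X \<Longrightarrow> (u, w) \<in> free_rel X"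

definition free_group :: "'a set \<Rightarrow> 'a word set monoid"
  where "free_group X =
    \<lparr>carrier = words X // free_rel X,
     mult = \<lambda>A B. \<Union>u\<in>A. \<Union>v\<in>B. free_rel X `` {u @ v},
     one = free_rel X `` {[]}\<rparr>"

definition free_gen :: "'a set \<Rightarrow> 'a \<Rightarrow> 'a word set"
  where "free_gen X x = free_rel X `` {[(x, True)]}"

lemma words_simps [simp]:
  "[] \<in> words X"
  "a # u \<in> words X \<longleftrightarrow> fst a \<in> X \<and> u \<in> words X"
  "u @ v \<in> words X \<longleftrightarrow> u \<in> words X \<and> v \<in> words X"
  by (auto simp: words_def mem_Times_iff)

lemma free_rel_words: "(u, v) \<in> free_rel X \<Longrightarrow> u \<in> words X \<and> v \<in> words X"
  by (induction rule: free_rel.induct) auto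

lemma equiv_free_rel: "equiv (words X) (free_rel X)"
proof (rule equivI)
  show "free_rel X \<subseteq> words X \<times> words X"
    using free_rel_words by fast
  show "refl_on (words X) (free_rel X)"
    by (rule refl_onI) (rule free_rel.refl)
  show "sym (free_rel X)"
    by (rule symI) (rule free_rel.sym)
  show "trans (free_rel X)"
    by (rule transI) (rule free_rel.trans)
qed

lemma free_rel_append_left:
  "(u, v) \<in> free_rel X \<Longrightarrow> w \<in> words X \<Longrightarrow> (w @ u, w @ v) \<in> free_rel X"
proof (induction rule: free_rel.induct)
  case (cancel u v x b)
  then show ?case using free_rel.cancel[of "w @ u" X v x b] by simp
next
  case (refl u)
  then show ?case by (simp add: free_rel.refl)
next
  case (sym u v)
  then show ?case by (simp add: free_rel.sym)
next
  case (trans u v v')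
  then show ?case by (metis free_rel.trans)
qed

lemma free_rel_append_right:
  "(u, v) \<in> free_rel X \<Longrightarrow> w \<in> words X \<Longrightarrow> (u @ w, v @ w) \<in> free_rel X"
proof (induction rule: free_rel.induct)
  case (cancel u v x b)
  then show ?case using free_rel.cancel[of u X "v @ w" x b] by simp
next
  case (refl u)
  then show ?case by (simp add: free_rel.refl)
next
  case (sym u v)
  then show ?case by (simp add: free_rel.sym)
next
  case (trans u v v')
  then show ?case by (metis free_rel.trans)
qed

lemma free_rel_append:
  assumes "(u, u') \<in> free_rel X" "(v, v') \<in> free_rel X"
  shows "(u @ v, u' @ v') \<in> free_rel X"
  using free_rel_append_right[OF assms(1)] free_rel_append_left[OF assms(2)]
    free_rel_words[OF assms(1)] free_rel_words[OF assms(2)]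
  by (metis free_rel.trans)

lemma free_group_mult:
  assumes "u \<in> words X" "v \<in> words X"
  shows "free_rel X `` {u} \<otimes>\<^bsub>free_group X\<^esub> free_rel X `` {v} = free_rel X `` {u @ v}"
proof -
  have "free_rel X `` {u' @ v'} = free_rel X `` {u @ v}"
    if "(u, u') \<in> free_rel X" "(v, v') \<in> free_rel X" for u' v'
    using equiv_class_eq[OF equiv_free_rel free_rel_append[OF that]] by simp
  then have "(\<Union>u'\<in>free_rel X `` {u}. \<Union>v'\<in>free_rel X `` {v}. free_rel X `` {u' @ v'}) =
      (\<Union>u'\<in>free_rel X `` {u}. \<Union>v'\<in>free_rel X `` {v}. free_rel X `` {u @ v})"
    by (intro SUP_cong) simp_all
  moreover have "free_rel X `` {u} \<noteq> {}" "free_rel X `` {v} \<noteq> {}"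
    using assms free_rel.refl by fast+
  ultimately show ?thesis
    by (simp add: free_group_def)
qed

lemma free_group_carrierE:
  assumes "A \<in> carrier (free_group X)"
  obtains u where "u \<in> words X" "A = free_rel X `` {u}"
  using assms by (auto simp: free_group_def elim: quotientE)

lemma free_group_carrierI: "u \<in> words X \<Longrightarrow> free_rel X `` {u} \<in> carrier (free_group X)"
  by (auto simp: free_group_def intro: quotientI)

lemma free_group_one: "\<one>\<^bsub>free_group X\<^esub> = free_rel X `` {[]}"
  by (simp add: free_group_def)

lemma free_word_inverse:
  "u \<in> words X \<Longrightarrow> (map (apsnd Not) (rev u) @ u, []) \<in> free_rel X \<and> map (apsnd Not) (rev u) \<in> words X"
proof (induction u)
  case Nil
  then show ?case by (simp add: free_rel.refl)
next
  case (Cons a u)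
  obtain x b where a: "a = (x, b)" by (cases a)
  with Cons have u: "x \<in> X" "u \<in> words X" "map (apsnd Not) (rev u) \<in> words X"
    "(map (apsnd Not) (rev u) @ u, []) \<in> free_rel X"
    by auto
  have "(map (apsnd Not) (rev u) @ [(x, \<not> b), (x, \<not> \<not> b)] @ u, map (apsnd Not) (rev u) @ u) \<in> free_rel X"
    using u by (intro free_rel.cancel)
  from free_rel.trans[OF this u(4)] show ?case
    using u a by simp
qed

lemma group_free_group: "group (free_group X)"
proof (rule groupI)
  fix A B assume "A \<in> carrier (free_group X)" "B \<in> carrier (free_group X)"
  then show "A \<otimes>\<^bsub>free_group X\<^esub> B \<in> carrier (free_group X)"
    by (elim free_group_carrierE) (simp add: free_group_mult free_group_carrierI)
next
  fix A B C
  assume "A \<in> carrier (free_group X)" "B \<in> carrier (free_group X)" "C \<in> carrier (free_group X)"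
  then show "A \<otimes>\<^bsub>free_group X\<^esub> B \<otimes>\<^bsub>free_group X\<^esub> C = A \<otimes>\<^bsub>free_group X\<^esub> (B \<otimes>\<^bsub>free_group X\<^esub> C)"
    by (elim free_group_carrierE) (simp add: free_group_mult)
next
  fix A assume "A \<in> carrier (free_group X)"
  then show "\<one>\<^bsub>free_group X\<^esub> \<otimes>\<^bsub>free_group X\<^esub> A = A"
    by (elim free_group_carrierE) (simp add: free_group_mult free_group_one)
next
  fix A assume "A \<in> carrier (free_group X)"
  then obtain u where u: "u \<in> words X" "A = free_rel X `` {u}" by (rule free_group_carrierE)
  then show "\<exists>B\<in>carrier (free_group X). B \<otimes>\<^bsub>free_group X\<^esub> A = \<one>\<^bsub>free_group X\<^esub>"
    using free_word_inverse[OF u(1)] equiv_class_eq[OF equiv_free_rel]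
    by (intro bexI[of _ "free_rel X `` {map (apsnd Not) (rev u)}"])
       (auto simp: free_group_mult free_group_one intro: free_group_carrierI)
qed (simp add: free_group_one free_group_carrierI)

lemma free_gen_closed: "x \<in> X \<Longrightarrow> free_gen X x \<in> carrier (free_group X)"
  by (simp add: free_gen_def free_group_carrierI)

section \<open>Quotients by relations and presentations\<close>

definition normal_closure :: "('a, 'b) monoid_scheme \<Rightarrow> 'a set \<Rightarrow> 'a set"
  where "normal_closure G S = \<Inter> {N. N \<lhd> G \<and> S \<subseteq> N}"

text \<open>A relation \<open>l = r\<close> between elements of a group is encoded as the pair \<open>(l, r)\<close>.\<close>

definition relators :: "('a, 'b) monoid_scheme \<Rightarrow> ('a \<times> 'a) set \<Rightarrow> 'a set"
  where "relators G R = {l \<otimes>\<^bsub>G\<^esub> inv\<^bsub>G\<^esub> r | l r. (l, r) \<in> R}"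

definition rel_quotient :: "('a, 'b) monoid_scheme \<Rightarrow> ('a \<times> 'a) set \<Rightarrow> 'a set monoid"
  where "rel_quotient G R = G Mod normal_closure G (relators G R)"

definition rel_class :: "('a, 'b) monoid_scheme \<Rightarrow> ('a \<times> 'a) set \<Rightarrow> 'a \<Rightarrow> 'a set"
  where "rel_class G R g = normal_closure G (relators G R) #>\<^bsub>G\<^esub> g"

definition presented_group :: "'a set \<Rightarrow> ('a word set \<times> 'a word set) set \<Rightarrow> 'a word set set monoid"
  where "presented_group X R = rel_quotient (free_group X) R"

definition presented_gen :: "'a set \<Rightarrow> ('a word set \<times> 'a word set) set \<Rightarrow> 'a \<Rightarrow> 'a word set set"
  where "presented_gen X R x = rel_class (free_group X) R (free_gen X x)"

text \<open>\<open>has_presentation G X g R\<close>: the group \<open>G\<close> is presented by the generators \<open>g x\<close>,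
  \<open>x \<in> X\<close>, and the relations \<open>R\<close>.\<close>

definition has_presentation ::
  "('g, 'h) monoid_scheme \<Rightarrow> 'a set \<Rightarrow> ('a \<Rightarrow> 'g) \<Rightarrow> ('a word set \<times> 'a word set) set \<Rightarrow> bool"
  where "has_presentation G X g R \<longleftrightarrow>
    R \<subseteq> carrier (free_group X) \<times> carrier (free_group X) \<and>
    (\<exists>h \<in> iso (presented_group X R) G. \<forall>x\<in>X. h (presented_gen X R x) = g x)"

lemma normal_closure_normal:
  assumes "group G" "S \<subseteq> carrier G"
  shows "normal_closure G S \<lhd> G"
proof -
  interpret group G by fact
  have "carrier G \<lhd> G"
    by (simp add: normal_inv_iff subgroup_self)
  then have "carrier G \<in> {N. N \<lhd> G \<and> S \<subseteq> N}"
    using assms by simp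
  then show ?thesis
    unfolding normal_closure_def normal_inv_iff
    by (auto intro!: subgroups_Inter)
qed

lemma relators_closed:
  assumes "group G" "R \<subseteq> carrier G \<times> carrier G"
  shows "relators G R \<subseteq> carrier G"
proof -
  interpret group G by fact
  show ?thesis
    using assms(2) by (auto simp: relators_def)
qed

lemma group_rel_quotient:
  assumes "group G" "R \<subseteq> carrier G \<times> carrier G"
  shows "group (rel_quotient G R)"
  unfolding rel_quotient_def
  by (rule normal.factorgroup_is_group[OF normal_closure_normal[OF assms(1) relators_closed[OF assms]]])

section \<open>The braid group and the Coxeter group of type E8\<close>

datatype e8_gen = ESigma nat | EOmega

definition E8_gens :: "e8_gen set"
  where "E8_gens = ESigma ` {1..7} \<union> {EOmega}"

definition E8_braid_rels :: "(e8_gen word set \<times> e8_gen word set) set"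
  where "E8_braid_rels =
    (let F = free_group E8_gens;
         s = \<lambda>i. free_gen E8_gens (ESigma i);
         w = free_gen E8_gens EOmega
     in {(s i \<otimes>\<^bsub>F\<^esub> s j, s j \<otimes>\<^bsub>F\<^esub> s i) | i j.
           i \<in> {1..7} \<and> j \<in> {1..7} \<and> \<bar>int i - int j\<bar> > 1} \<union>
        {(s i \<otimes>\<^bsub>F\<^esub> s (i + 1) \<otimes>\<^bsub>F\<^esub> s i, s (i + 1) \<otimes>\<^bsub>F\<^esub> s i \<otimes>\<^bsub>F\<^esub> s (i + 1)) | i.
           i \<in> {1..6}} \<union>
        {(w \<otimes>\<^bsub>F\<^esub> s i, s i \<otimes>\<^bsub>F\<^esub> w) | i. i \<in> {1..7} \<and> i \<noteq> 3} \<union>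
        {(w \<otimes>\<^bsub>F\<^esub> s 3 \<otimes>\<^bsub>F\<^esub> w, s 3 \<otimes>\<^bsub>F\<^esub> w \<otimes>\<^bsub>F\<^esub> s 3)})"

definition braid_E8 :: "e8_gen word set set monoid"
  where "braid_E8 = presented_group E8_gens E8_braid_rels"

definition braid_E8_gen :: "e8_gen \<Rightarrow> e8_gen word set set"
  where "braid_E8_gen x = presented_gen E8_gens E8_braid_rels x"

definition E8_square_rels :: "(e8_gen word set set \<times> e8_gen word set set) set"
  where "E8_square_rels =
    {(braid_E8_gen x \<otimes>\<^bsub>braid_E8\<^esub> braid_E8_gen x, \<one>\<^bsub>braid_E8\<^esub>) | x. x \<in> E8_gens}"

definition coxeter_E8 :: "e8_gen word set set set monoid"
  where "coxeter_E8 = rel_quotient braid_E8 E8_square_rels"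

definition coxeter_E8_gen :: "e8_gen \<Rightarrow> e8_gen word set set set"
  where "coxeter_E8_gen x = rel_class braid_E8 E8_square_rels (braid_E8_gen x)"

section \<open>The relations in three generators\<close>

datatype gen3 = Gsigma1 | Gsigma | Gomega

text \<open>The elements \<open>\<sigma>\<^sub>1\<close>, \<open>\<sigma> = \<sigma>\<^sub>1 \<cdots> \<sigma>\<^sub>7\<close> and \<open>\<omega>\<close> of a group \<open>G\<close> with a family \<open>g\<close> of
  canonical generators.\<close>

fun three_gens :: "('g, 'h) monoid_scheme \<Rightarrow> (e8_gen \<Rightarrow> 'g) \<Rightarrow> gen3 \<Rightarrow> 'g"
  where
    "three_gens G g Gsigma1 = g (ESigma 1)"
  | "three_gens G g Gsigma =
       g (ESigma 1) \<otimes>\<^bsub>G\<^esub> g (ESigma 2) \<otimes>\<^bsub>G\<^esub> g (ESigma 3) \<otimes>\<^bsub>G\<^esub> g (ESigma 4) \<otimes>\<^bsub>G\<^esub>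
       g (ESigma 5) \<otimes>\<^bsub>G\<^esub> g (ESigma 6) \<otimes>\<^bsub>G\<^esub> g (ESigma 7)"
  | "three_gens G g Gomega = g EOmega"

definition three_gen_braid_rels :: "(gen3 word set \<times> gen3 word set) set"
  where "three_gen_braid_rels =
    (let F = free_group UNIV;
         s1 = free_gen UNIV Gsigma1;
         s = free_gen UNIV Gsigma;
         w = free_gen UNIV Gomega;
         c = \<lambda>i::int. s [^]\<^bsub>F\<^esub> i \<otimes>\<^bsub>F\<^esub> s1 \<otimes>\<^bsub>F\<^esub> s [^]\<^bsub>F\<^esub> (- i)
     in {(s1 \<otimes>\<^bsub>F\<^esub> c i, c i \<otimes>\<^bsub>F\<^esub> s1) | i. i \<in> {2, 3, 4}} \<union>
        {(s [^]\<^bsub>F\<^esub> (8::nat), (s \<otimes>\<^bsub>F\<^esub> s1) [^]\<^bsub>F\<^esub> (7::nat))} \<union>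
        {(w \<otimes>\<^bsub>F\<^esub> c i, c i \<otimes>\<^bsub>F\<^esub> w) | i. i \<in> {0, 1, 3, 4, 5, 6}} \<union>
        {(w \<otimes>\<^bsub>F\<^esub> c 2 \<otimes>\<^bsub>F\<^esub> w, c 2 \<otimes>\<^bsub>F\<^esub> w \<otimes>\<^bsub>F\<^esub> c 2)})"

definition three_gen_square_rels :: "(gen3 word set \<times> gen3 word set) set"
  where "three_gen_square_rels =
    (let F = free_group UNIV
     in {(free_gen UNIV Gsigma1 [^]\<^bsub>F\<^esub> (2::nat), \<one>\<^bsub>F\<^esub>),
         (free_gen UNIV Gomega [^]\<^bsub>F\<^esub> (2::nat), \<one>\<^bsub>F\<^esub>)})"

end

theory Submission
  imports Defs "HOL-Algebra.Generated_Groups"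
begin

(* In any group write c(i) = s^i a s^(-i).  Since s c(i) = c(i+1) s, we have
   (s a)^n = c(1) ... c(n) s^n, so s^8 = (s a)^7 says precisely that s = c(1) ... c(7),
   equivalently s = c(0) ... c(6).  It also makes s^8 central, because s^8 commutes with both s
   and s a; hence c(i+8) = c(i), and the commutations at distance 2, 3, 4 give those at
   distance 5 and 6.  Finally s c(0) = c(1) s, with s = c(0) ... c(6), becomes the braid relation of c(0)
   and c(1) after cancelling c(2) ... c(6).  Conversely, the braid relations give
   s sigma_i = sigma_(i+1) s for s = sigma_1 ... sigma_7, that is sigma_(i+1) = c(i).  The two
   substitutions are inverse to each other on generators. *)

section \<open>Homomorphisms out of presented groups\<close>

text \<open>The relations among sigma_1, ..., sigma_7 are those of the braid group on 8 strands, and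
  the constants come from there. With the strands placed on a circle, sigma rotates them by one
  place, and the c(i), with i taken modulo 8, are the half twists of neighbouring strands, c(7)
  being the one that closes the circle. Both sigma^8 and (sigma sigma_1)^7 are the full twist, hence
  the exponents 8 and 7.

  The Coxeter group is a quotient of the braid group, which is itself a quotient of a free group.
  Nested cosets are avoided by working with homomorphisms and their values on generators. The
  computations concern elements of an arbitrary group, and both presentations are instances of
  \<open>three_gens_presentation\<close>; they differ only in how a map out of the group is
  obtained.\<close>

primrec word_eval :: "('g, 'h) monoid_scheme \<Rightarrow> ('a \<Rightarrow> 'g) \<Rightarrow> 'a word \<Rightarrow> 'g"
  where
    "word_eval G f [] = \<one>\<^bsub>G\<^esub>"
  | "word_eval G f (a # u) =
      (if snd a then f (fst a) else inv\<^bsub>G\<^esub> f (fst a)) \<otimes>\<^bsub>G\<^esub> word_eval G f u"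

context group
begin

lemma word_eval_closed: "f \<in> X \<rightarrow> carrier G \<Longrightarrow> u \<in> words X \<Longrightarrow> word_eval G f u \<in> carrier G"
  by (induction u) auto

lemma word_eval_append:
  assumes f: "f \<in> X \<rightarrow> carrier G" and v: "v \<in> words X"
  shows "u \<in> words X \<Longrightarrow> word_eval G f (u @ v) = word_eval G f u \<otimes> word_eval G f v"
proof (induction u)
  case Nil
  then show ?case using word_eval_closed[OF f v] by simp
next
  case (Cons a u)
  then show ?case
    using f word_eval_closed[OF f v] word_eval_closed[OF f, of u]
    by (cases a) (auto simp: m_assoc Pi_iff)
qed

lemma word_eval_free_rel:
  assumes f: "f \<in> X \<rightarrow> carrier G"
  shows "(u, v) \<in> free_rel X \<Longrightarrow> word_eval G f u = word_eval G f v"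
proof (induction rule: free_rel.induct)
  case (cancel u v x b)
  then have "f x \<in> carrier G" "word_eval G f v \<in> carrier G"
    using f word_eval_closed[OF f] by auto
  then have "word_eval G f ([(x, b), (x, \<not> b)] @ v) = word_eval G f v"
    by (cases b) (simp_all add: m_assoc[symmetric])
  then show ?case
    using cancel word_eval_append[OF f, of _ u] by simp
qed auto

lemma free_group_hom_exists:
  assumes f: "f \<in> X \<rightarrow> carrier G"
  obtains h where "h \<in> hom (free_group X) G" "\<And>x. x \<in> X \<Longrightarrow> h (free_gen X x) = f x"
proof -
  \<comment> \<open>Evaluation is constant on each class of \<open>free_rel X\<close>, so its image
    on a class is a singleton and \<open>the_elem\<close> reads off the value without choosing a
    representative.\<close>
  define h where "h A = the_elem (word_eval G f ` A)" for A
  have h: "h (free_rel X `` {u}) = word_eval G f u" if u: "u \<in> words X" for u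
  proof -
    have "u \<in> free_rel X `` {u}"
      using free_rel.refl[OF u] by simp
    moreover have "word_eval G f v = word_eval G f u" if "v \<in> free_rel X `` {u}" for v
      using that word_eval_free_rel[OF f, of u v] by simp
    ultimately have "word_eval G f ` (free_rel X `` {u}) = {word_eval G f u}"
      by (metis (no_types, lifting) empty_iff image_constant_conv image_cong)
    then show ?thesis by (simp add: h_def)
  qed
  show thesis
  proof
    show "h \<in> hom (free_group X) G"
    proof (rule homI)
      fix A assume "A \<in> carrier (free_group X)"
      then show "h A \<in> carrier G"
        by (elim free_group_carrierE) (simp add: h word_eval_closed[OF f])
    next
      fix A B assume "A \<in> carrier (free_group X)" "B \<in> carrier (free_group X)"
      then show "h (A \<otimes>\<^bsub>free_group X\<^esub> B) = h A \<otimes> h B"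
        by (elim free_group_carrierE) (simp add: h free_group_mult word_eval_append[OF f])
    qed
    show "h (free_gen X x) = f x" if "x \<in> X" for x
      using that f r_one[of "f x"] by (auto simp: free_gen_def h Pi_iff)
  qed
qed

end

lemma free_group_generate: "generate (free_group X) (free_gen X ` X) = carrier (free_group X)"
proof
  interpret group "free_group X" by (rule group_free_group)
  have sub: "free_gen X ` X \<subseteq> carrier (free_group X)"
    by (auto simp: free_gen_closed)
  then show "generate (free_group X) (free_gen X ` X) \<subseteq> carrier (free_group X)"
    by (rule generate_incl)
  have "free_rel X `` {u} \<in> generate (free_group X) (free_gen X ` X)" if "u \<in> words X" for u
    using that
  proof (induction u)
    case Nil
    then show ?case using generate.one[of "free_group X"] by (simp add: free_group_one)
  next
    case (Cons a u)
    obtain x b where a: "a = (x, b)" by (cases a)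
    with Cons.prems have x: "x \<in> X" and u: "u \<in> words X" by auto
    have "free_rel X `` {[(x, b)]} \<in> generate (free_group X) (free_gen X ` X)"
    proof (cases b)
      case True
      then show ?thesis
        using generate.incl[of "free_gen X x" "free_gen X ` X"] x unfolding free_gen_def by auto
    next
      case False
      \<comment> \<open>An inverse letter is not the class of a generator; it is recognised as the
        group inverse of one, which \<open>generate\<close> admits.\<close>
      have "([(x, False), (x, True)], []) \<in> free_rel X"
        using free_rel.cancel[of "[]" X "[]" x False] x by simp
      then have "free_rel X `` {[(x, False)]} \<otimes>\<^bsub>free_group X\<^esub> free_gen X x = \<one>\<^bsub>free_group X\<^esub>"
        using x equiv_class_eq[OF equiv_free_rel]
        by (auto simp: free_gen_def free_group_mult free_group_one)
      then have "inv\<^bsub>free_group X\<^esub> free_gen X x = free_rel X `` {[(x, False)]}"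
        using x by (intro inv_equality) (simp_all add: free_gen_closed free_group_carrierI)
      then show ?thesis
        using False x generate.inv[of "free_gen X x" "free_gen X ` X" "free_group X"] by simp
    qed
    from generate.eng[OF this Cons.IH[OF u]] show ?case
      using a x u by (simp add: free_group_mult)
  qed
  then show "carrier (free_group X) \<subseteq> generate (free_group X) (free_gen X ` X)"
    by (auto elim: free_group_carrierE)
qed

text \<open>The uniqueness that complements the existence of homomorphisms: it reduces the claim
  that a composite is the identity to a check on generators.\<close>

lemma hom_eq_on_generate:
  assumes G: "group G" and H: "group H" and f: "f \<in> hom G H" and g: "g \<in> hom G H"
    and S: "S \<subseteq> carrier G" and eq: "\<And>x. x \<in> S \<Longrightarrow> f x = g x"
    and x: "x \<in> generate G S"
  shows "f x = g x"
proof -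
  interpret f: group_hom G H f using G H f by (simp add: group_hom_def group_hom_axioms_def)
  interpret g: group_hom G H g using G H g by (simp add: group_hom_def group_hom_axioms_def)
  show ?thesis
    using x
  proof (induction rule: generate.induct)
    case (eng a b)
    then show ?case using f.G.generate_in_carrier[OF S] by simp
  qed (use S eq in auto)
qed

section \<open>Universal properties of quotients by relations and of presented groups\<close>

lemma rel_class_hom:
  assumes "group G" "R \<subseteq> carrier G \<times> carrier G"
  shows "rel_class G R \<in> hom G (rel_quotient G R)"
proof -
  interpret normal "normal_closure G (relators G R)" G
    using assms by (intro normal_closure_normal relators_closed)
  show ?thesis
    unfolding rel_quotient_def rel_class_def by (rule r_coset_hom_Mod)
qed

lemma rel_class_surj: "rel_class G R ` carrier G = carrier (rel_quotient G R)"
  by (simp add: rel_quotient_def rel_class_def carrier_FactGroup)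

lemma rel_class_eq:
  assumes G: "group G" and R: "R \<subseteq> carrier G \<times> carrier G" and lr: "(l, r) \<in> R"
  shows "rel_class G R l = rel_class G R r"
proof -
  interpret group G by fact
  let ?N = "normal_closure G (relators G R)"
  have N: "?N \<lhd> G"
    using assms by (intro normal_closure_normal relators_closed)
  have "l \<otimes>\<^bsub>G\<^esub> inv\<^bsub>G\<^esub> r \<in> ?N"
    using lr by (auto simp: normal_closure_def relators_def)
  then have "l \<in> ?N #>\<^bsub>G\<^esub> r"
    using N R lr normal_imp_subgroup[OF N] by (intro subgroup.rcos_module_rev) auto
  then show ?thesis
    unfolding rel_class_def using R lr normal_imp_subgroup[OF N]
    by (intro repr_independence[symmetric]) auto
qed

text \<open>The kernel of \<open>h\<close> is normal and contains every relator
  \<open>l r^-1\<close>, hence the whole normal closure, so \<open>h\<close> factors through the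
  quotient.\<close>

lemma rel_quotient_hom_exists:
  assumes G: "group G" and R: "R \<subseteq> carrier G \<times> carrier G"
    and H: "group H" and h: "h \<in> hom G H" and eq: "\<And>l r. (l, r) \<in> R \<Longrightarrow> h l = h r"
  obtains k where "k \<in> hom (rel_quotient G R) H"
    "\<And>x. x \<in> carrier G \<Longrightarrow> k (rel_class G R x) = h x"
proof -
  interpret group_hom G H h
    using G H h by (simp add: group_hom_def group_hom_axioms_def)
  have N: "normal_closure G (relators G R) \<lhd> G"
    using assms by (intro normal_closure_normal relators_closed)
  have "relators G R \<subseteq> kernel G H h"
  proof
    fix y assume "y \<in> relators G R"
    then obtain l r where "(l, r) \<in> R" and y: "y = l \<otimes>\<^bsub>G\<^esub> inv\<^bsub>G\<^esub> r"
      by (auto simp: relators_def)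
    then show "y \<in> kernel G H h"
      using R eq[of l r] by (auto simp: kernel_def)
  qed
  then have "normal_closure G (relators G R) \<subseteq> kernel G H h"
    using normal_kernel by (auto simp: normal_closure_def)
  from FactGroup_universal_kernel[OF N this] obtain k
    where "k \<in> hom (G Mod normal_closure G (relators G R)) H"
      "\<And>x. x \<in> carrier G \<Longrightarrow> k (normal_closure G (relators G R) #>\<^bsub>G\<^esub> x) = h x"
    by blast
  then show thesis
    by (intro that) (simp_all add: rel_quotient_def rel_class_def)
qed

lemma rel_quotient_generate:
  assumes G: "group G" and R: "R \<subseteq> carrier G \<times> carrier G"
    and S: "S \<subseteq> carrier G" "generate G S = carrier G"
  shows "generate (rel_quotient G R) (rel_class G R ` S) = carrier (rel_quotient G R)"
proof -
  interpret group_hom G "rel_quotient G R" "rel_class G R"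
    using G group_rel_quotient[OF G R] rel_class_hom[OF G R]
    by (simp add: group_hom_def group_hom_axioms_def)
  show ?thesis using generate_img[OF S(1)] S(2) by (simp add: rel_class_surj)
qed

lemma group_presented_group:
  "R \<subseteq> carrier (free_group X) \<times> carrier (free_group X) \<Longrightarrow> group (presented_group X R)"
  unfolding presented_group_def by (intro group_rel_quotient group_free_group)

lemma presented_gen_closed:
  assumes "R \<subseteq> carrier (free_group X) \<times> carrier (free_group X)" "x \<in> X"
  shows "presented_gen X R x \<in> carrier (presented_group X R)"
  unfolding presented_group_def presented_gen_def
  using rel_class_surj[of "free_group X" R] free_gen_closed[OF assms(2)] by blast

lemma presented_group_generate:
  assumes "R \<subseteq> carrier (free_group X) \<times> carrier (free_group X)"
  shows "generate (presented_group X R) (presented_gen X R ` X) = carrier (presented_group X R)"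
proof -
  have "presented_gen X R ` X = rel_class (free_group X) R ` free_gen X ` X"
    by (auto simp: presented_gen_def)
  moreover have "free_gen X ` X \<subseteq> carrier (free_group X)"
    by (auto simp: free_gen_closed)
  ultimately show ?thesis
    unfolding presented_group_def
    using rel_quotient_generate[OF group_free_group assms _ free_group_generate] by simp
qed

text \<open>The map on the free group is known only to exist, so \<open>eq\<close> quantifies over
  every homomorphism with the prescribed values on generators; such values suffice to evaluate both
  sides of a relation.\<close>

lemma presented_group_hom_exists:
  assumes R: "R \<subseteq> carrier (free_group X) \<times> carrier (free_group X)" and H: "group H"
    and f: "f \<in> X \<rightarrow> carrier H"
    and eq: "\<And>h l r. \<lbrakk>h \<in> hom (free_group X) H; \<And>x. x \<in> X \<Longrightarrow> h (free_gen X x) = f x; (l, r) \<in> R\<rbrakk>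
      \<Longrightarrow> h l = h r"
  obtains k where "k \<in> hom (presented_group X R) H" "\<And>x. x \<in> X \<Longrightarrow> k (presented_gen X R x) = f x"
proof -
  obtain h where h: "h \<in> hom (free_group X) H" "\<And>x. x \<in> X \<Longrightarrow> h (free_gen X x) = f x"
    using group.free_group_hom_exists[OF H f] by blast
  obtain k where k: "k \<in> hom (rel_quotient (free_group X) R) H"
    "\<And>x. x \<in> carrier (free_group X) \<Longrightarrow> k (rel_class (free_group X) R x) = h x"
    using rel_quotient_hom_exists[OF group_free_group R H h(1) eq[OF h]] by blast
  show thesis
  proof
    show "k \<in> hom (presented_group X R) H"
      using k(1) by (simp add: presented_group_def)
    show "k (presented_gen X R x) = f x" if "x \<in> X" for x
      using that k(2) h(2) by (simp add: presented_gen_def free_gen_closed)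
  qed
qed

text \<open>The map \<open>h\<close> from the presented group and the given \<open>k\<close> are
  mutually inverse because each composite fixes a generating set. The set \<open>S\<close> is kept
  apart from the image of \<open>g\<close>: in the application \<open>G\<close> is known to be
  generated by its eight canonical generators, while \<open>g\<close> names only three
  elements.\<close>

lemma has_presentationI:
  assumes G: "group G" and R: "R \<subseteq> carrier (free_group X) \<times> carrier (free_group X)"
    and g: "g \<in> X \<rightarrow> carrier G"
    and eq: "\<And>h l r. \<lbrakk>h \<in> hom (free_group X) G; \<And>x. x \<in> X \<Longrightarrow> h (free_gen X x) = g x; (l, r) \<in> R\<rbrakk>
      \<Longrightarrow> h l = h r"
    and S: "S \<subseteq> carrier G" "generate G S = carrier G"
    and k: "k \<in> hom G (presented_group X R)" "\<And>x. x \<in> X \<Longrightarrow> k (g x) = presented_gen X R x"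
    and kS: "\<And>h y. \<lbrakk>h \<in> hom (presented_group X R) G; \<And>x. x \<in> X \<Longrightarrow> h (presented_gen X R x) = g x;
      y \<in> S\<rbrakk> \<Longrightarrow> h (k y) = y"
  shows "has_presentation G X g R"
proof -
  let ?P = "presented_group X R"
  have P: "group ?P" by (rule group_presented_group[OF R])
  obtain h where h: "h \<in> hom ?P G" "\<And>x. x \<in> X \<Longrightarrow> h (presented_gen X R x) = g x"
    by (rule presented_group_hom_exists[OF R G g]) (blast intro: eq that)+
  have id: "(\<lambda>x. x) \<in> hom A A" for A :: "('u, 'v) monoid_scheme"
    by (auto intro: homI)
  have hk: "h (k y) = y" if "y \<in> carrier G" for y
    using hom_eq_on_generate[OF G G hom_compose[OF k(1) h(1)] id S(1), of y] kS[OF h] S(2) that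
    by auto
  have kh: "k (h y) = y" if "y \<in> carrier ?P" for y
  proof -
    have "presented_gen X R ` X \<subseteq> carrier ?P"
      using presented_gen_closed[OF R] by blast
    moreover have "(k \<circ> h) z = z" if "z \<in> presented_gen X R ` X" for z
      using that h(2) k(2) by auto
    ultimately show ?thesis
      using hom_eq_on_generate[OF P P hom_compose[OF h(1) k(1)] id, of "presented_gen X R ` X" y]
        presented_group_generate[OF R] that
      by simp
  qed
  have "bij_betw h (carrier ?P) (carrier G)"
    using hk kh h(1) k(1) by (intro bij_betwI[of _ _ _ k]) (auto simp: hom_def)
  then have "h \<in> iso ?P G"
    using h(1) by (simp add: iso_def)
  then show ?thesis
    using R h(2) by (auto simp: has_presentation_def)
qed


section \<open>Conjugates by powers\<close>

primrec seq_prod :: "('g, 'h) monoid_scheme \<Rightarrow> (nat \<Rightarrow> 'g) \<Rightarrow> nat \<Rightarrow> 'g"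
  where
    "seq_prod G x 0 = \<one>\<^bsub>G\<^esub>"
  | "seq_prod G x (Suc n) = seq_prod G x n \<otimes>\<^bsub>G\<^esub> x n"

text \<open>The body copies the local abbreviation \<open>c\<close> of
  \<open>three_gen_braid_rels\<close>, so it can be folded there. Integer exponents allow shifts in
  both directions and the index \<open>int i - 1\<close> without truncation.\<close>

definition conj_pow :: "('g, 'h) monoid_scheme \<Rightarrow> 'g \<Rightarrow> 'g \<Rightarrow> int \<Rightarrow> 'g"
  where "conj_pow G s a i = s [^]\<^bsub>G\<^esub> i \<otimes>\<^bsub>G\<^esub> a \<otimes>\<^bsub>G\<^esub> s [^]\<^bsub>G\<^esub> (- i)"

context group
begin

lemma seq_prod_closed: "(\<And>i. i < n \<Longrightarrow> x i \<in> carrier G) \<Longrightarrow> seq_prod G x n \<in> carrier G"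
  by (induction n) auto

lemma seq_prod_add:
  "(\<And>i. i < m + n \<Longrightarrow> x i \<in> carrier G) \<Longrightarrow>
    seq_prod G x (m + n) = seq_prod G x m \<otimes> seq_prod G (\<lambda>i. x (m + i)) n"
proof (induction n)
  case 0
  then show ?case by (simp add: seq_prod_closed)
next
  case (Suc n)
  then show ?case by (simp add: seq_prod_closed m_assoc)
qed

lemma seq_prod_commute:
  assumes "y \<in> carrier G"
  shows "(\<And>i. i < n \<Longrightarrow> x i \<in> carrier G \<and> y \<otimes> x i = x i \<otimes> y) \<Longrightarrow>
    y \<otimes> seq_prod G x n = seq_prod G x n \<otimes> y"
proof (induction n)
  case 0
  then show ?case using assms by simp
next
  case (Suc n)
  have P: "seq_prod G x n \<in> carrier G"
    using Suc.prems by (intro seq_prod_closed) auto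
  have x: "x n \<in> carrier G" "y \<otimes> x n = x n \<otimes> y"
    using Suc.prems by auto
  have "y \<otimes> (seq_prod G x n \<otimes> x n) = seq_prod G x n \<otimes> y \<otimes> x n"
    using Suc assms P x(1) by (simp add: m_assoc[symmetric])
  also have "\<dots> = seq_prod G x n \<otimes> x n \<otimes> y"
    using assms P x by (simp add: m_assoc)
  finally show ?case by simp
qed

text \<open>Pushing \<open>s\<close> through the product raises each index by one as it passes, so
  the window 0, ..., n-1 becomes 1, ..., n.\<close>

lemma seq_prod_shift:
  assumes s: "s \<in> carrier G"
  shows "(\<And>i. i \<le> n \<Longrightarrow> x i \<in> carrier G) \<Longrightarrow> (\<And>i. i < n \<Longrightarrow> s \<otimes> x i = x (Suc i) \<otimes> s) \<Longrightarrow>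
    s \<otimes> seq_prod G x n = seq_prod G (\<lambda>i. x (Suc i)) n \<otimes> s"
proof (induction n)
  case 0
  then show ?case using s by simp
next
  case (Suc n)
  have P: "seq_prod G x n \<in> carrier G" "seq_prod G (\<lambda>i. x (Suc i)) n \<in> carrier G"
    using Suc.prems by (auto intro: seq_prod_closed)
  have x: "x n \<in> carrier G" "x (Suc n) \<in> carrier G" "s \<otimes> x n = x (Suc n) \<otimes> s"
    using Suc.prems by auto
  have "s \<otimes> (seq_prod G x n \<otimes> x n) = seq_prod G (\<lambda>i. x (Suc i)) n \<otimes> s \<otimes> x n"
    using Suc s P x(1) by (simp add: m_assoc[symmetric])
  also have "\<dots> = seq_prod G (\<lambda>i. x (Suc i)) n \<otimes> x (Suc n) \<otimes> s"
    using s P x by (simp add: m_assoc)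
  finally show ?case by simp
qed

lemma conj_pow_closed [simp]:
  "s \<in> carrier G \<Longrightarrow> a \<in> carrier G \<Longrightarrow> conj_pow G s a i \<in> carrier G"
  by (simp add: conj_pow_def)

lemma conj_pow_0 [simp]: "a \<in> carrier G \<Longrightarrow> conj_pow G s a 0 = a"
  by (simp add: conj_pow_def)

lemma conj_pow_shift:
  assumes "s \<in> carrier G" "a \<in> carrier G"
  shows "s [^] (k::int) \<otimes> conj_pow G s a i = conj_pow G s a (k + i) \<otimes> s [^] k"
proof -
  \<comment> \<open>Splitting off \<open>s [^] k\<close> on the right leaves exactly the exponent
    that closes the conjugate of index \<open>k + i\<close>.\<close>
  have "s [^] (- i) = s [^] (- (k + i)) \<otimes> s [^] k"
    using assms by (simp add: int_pow_mult[symmetric])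
  then show ?thesis
    using assms by (simp add: conj_pow_def int_pow_mult[of s k i] m_assoc)
qed

lemma conj_pow_step:
  assumes "s \<in> carrier G" "a \<in> carrier G"
  shows "s \<otimes> conj_pow G s a i = conj_pow G s a (1 + i) \<otimes> s"
  using conj_pow_shift[OF assms, of 1 i] assms by simp

lemma conj_pow_commute_shift:
  assumes sa: "s \<in> carrier G" "a \<in> carrier G"
    and eq: "conj_pow G s a i \<otimes> conj_pow G s a j = conj_pow G s a j \<otimes> conj_pow G s a i"
  shows "conj_pow G s a (k + i) \<otimes> conj_pow G s a (k + j) =
    conj_pow G s a (k + j) \<otimes> conj_pow G s a (k + i)"
proof -
  \<comment> \<open>Conjugation by \<open>s [^] k\<close> translates indices by \<open>k\<close>.
    Written with \<open>s [^] k\<close> on both sides, this lets the relation be transported and the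
    power cancelled on the right.\<close>
  have *: "conj_pow G s a (k + u) \<otimes> conj_pow G s a (k + v) \<otimes> s [^] k =
      s [^] k \<otimes> (conj_pow G s a u \<otimes> conj_pow G s a v)" for u v
    using sa conj_pow_shift[OF sa, of k]
    by (simp add: m_assoc[symmetric]) (simp add: m_assoc)
  show ?thesis
    using *[of i j] *[of j i] eq sa by (metis conj_pow_closed int_pow_closed m_closed right_cancel)
qed

lemma conj_pow_braid_shift:
  assumes sa: "s \<in> carrier G" "a \<in> carrier G"
    and eq: "conj_pow G s a i \<otimes> conj_pow G s a j \<otimes> conj_pow G s a i =
      conj_pow G s a j \<otimes> conj_pow G s a i \<otimes> conj_pow G s a j"
  shows "conj_pow G s a (k + i) \<otimes> conj_pow G s a (k + j) \<otimes> conj_pow G s a (k + i) =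
    conj_pow G s a (k + j) \<otimes> conj_pow G s a (k + i) \<otimes> conj_pow G s a (k + j)"
proof -
  have *: "conj_pow G s a (k + u) \<otimes> conj_pow G s a (k + v) \<otimes> conj_pow G s a (k + u) \<otimes> s [^] k =
      s [^] k \<otimes> (conj_pow G s a u \<otimes> conj_pow G s a v \<otimes> conj_pow G s a u)" for u v
    using sa conj_pow_shift[OF sa, of k]
    by (simp add: m_assoc[symmetric]) (simp add: m_assoc)
  show ?thesis
    using *[of i j] *[of j i] eq sa by (metis conj_pow_closed int_pow_closed m_closed right_cancel)
qed

lemma pow_mult_eq_seq_prod:
  assumes sa: "s \<in> carrier G" "a \<in> carrier G"
  shows "(s \<otimes> a) [^] (n::nat) = seq_prod G (\<lambda>i. conj_pow G s a (1 + int i)) n \<otimes> s [^] n"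
proof (induction n)
  case 0
  then show ?case by simp
next
  case (Suc n)
  have P: "seq_prod G (\<lambda>i. conj_pow G s a (1 + int i)) n \<in> carrier G"
    using sa by (intro seq_prod_closed) simp
  \<comment> \<open>The last factor \<open>s a\<close> contributes one more \<open>s\<close> before
    its \<open>a\<close>, so the new conjugate has index n+1; this is why the product starts at
    index 1 and not 0.\<close>
  have "s [^] n \<otimes> s \<otimes> a = conj_pow G s a (1 + int n) \<otimes> (s [^] n \<otimes> s)"
    using conj_pow_shift[OF sa, of "1 + int n" 0] sa
    by (simp add: int_pow_mult int_pow_int nat_pow_Suc2[symmetric])
  then show ?case
    using Suc sa P by (simp add: m_assoc)
qed

lemma pow_Suc_eq_iff_seq_prod:
  assumes sa: "s \<in> carrier G" "a \<in> carrier G"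
  shows "s [^] Suc n = (s \<otimes> a) [^] n \<longleftrightarrow> s = seq_prod G (\<lambda>i. conj_pow G s a (int i)) n"
proof -
  define P where "P = seq_prod G (\<lambda>i. conj_pow G s a (int i)) n"
  define Q where "Q = seq_prod G (\<lambda>i. conj_pow G s a (1 + int i)) n"
  have cl: "P \<in> carrier G" "Q \<in> carrier G"
    using sa by (simp_all add: P_def Q_def seq_prod_closed)
  have "s \<otimes> P = Q \<otimes> s"
    unfolding P_def Q_def
    using seq_prod_shift[OF sa(1), of n "\<lambda>i. conj_pow G s a (int i)"] conj_pow_step[OF sa] sa
    by simp
  \<comment> \<open>If \<open>s = P\<close>, then \<open>s s = Q s\<close>; if \<open>s = Q\<close>,
    then \<open>s P = s s\<close>. Cancelling \<open>s\<close> gives the other equality in each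
    case.\<close>
  then have "s = P \<longleftrightarrow> s = Q"
    using sa cl by (metis Units_eq Units_l_cancel right_cancel)
  moreover have "s [^] Suc n = (s \<otimes> a) [^] n \<longleftrightarrow> s = Q"
    unfolding nat_pow_Suc2[OF sa(1)] pow_mult_eq_seq_prod[OF sa] Q_def[symmetric]
    using sa cl by simp
  ultimately show ?thesis by (simp add: P_def)
qed

lemma conj_pow_periodic:
  assumes sa: "s \<in> carrier G" "a \<in> carrier G" and eq: "s [^] (n::nat) = (s \<otimes> a) [^] (m::nat)"
  shows "conj_pow G s a (i + int n) = conj_pow G s a i"
proof -
  have "s [^] n \<otimes> (s \<otimes> a) = s \<otimes> a \<otimes> s [^] n"
    using eq sa nat_pow_Suc2[of "s \<otimes> a" m] by simp
  then have "s \<otimes> (s [^] n \<otimes> a) = s \<otimes> (a \<otimes> s [^] n)"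
    using sa nat_pow_Suc2[of s n] by (simp add: m_assoc[symmetric])
  then have "s [^] n \<otimes> a = a \<otimes> s [^] n"
    using sa by simp
  moreover have "s [^] n \<otimes> a = conj_pow G s a (int n) \<otimes> s [^] n"
    using conj_pow_shift[OF sa, of "int n" 0] sa by (simp add: int_pow_int)
  ultimately have "conj_pow G s a (int n) = conj_pow G s a 0"
    using sa by (metis conj_pow_0 conj_pow_closed nat_pow_closed right_cancel)
  \<comment> \<open>Only index 0 has been treated so far; multiplying by \<open>s [^] i\<close>
    translates the equality of the conjugates of index n and 0 to every \<open>i\<close>.\<close>
  then show ?thesis
    using conj_pow_shift[OF sa, of i] sa
    by (metis add.right_neutral conj_pow_closed int_pow_closed right_cancel)
qed

end

section \<open>The two families of relations\<close>

text \<open>A predicate on elements of any group, in contrast to the pairs of free group elements in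
  \<open>E8_braid_rels\<close>. The calculations are thus independent of how a group is constructed,
  and the same predicate serves the braid group, the Coxeter group and the targets of maps.\<close>

definition E8_relations :: "('g, 'h) monoid_scheme \<Rightarrow> (nat \<Rightarrow> 'g) \<Rightarrow> 'g \<Rightarrow> bool"
  where "E8_relations G x w \<longleftrightarrow>
    (\<forall>i\<in>{1..7}. \<forall>j\<in>{1..7}. \<bar>int i - int j\<bar> > 1 \<longrightarrow> x i \<otimes>\<^bsub>G\<^esub> x j = x j \<otimes>\<^bsub>G\<^esub> x i) \<and>
    (\<forall>i\<in>{1..6}. x i \<otimes>\<^bsub>G\<^esub> x (i + 1) \<otimes>\<^bsub>G\<^esub> x i = x (i + 1) \<otimes>\<^bsub>G\<^esub> x i \<otimes>\<^bsub>G\<^esub> x (i + 1)) \<and>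
    (\<forall>i\<in>{1..7}. i \<noteq> 3 \<longrightarrow> w \<otimes>\<^bsub>G\<^esub> x i = x i \<otimes>\<^bsub>G\<^esub> w) \<and>
    w \<otimes>\<^bsub>G\<^esub> x 3 \<otimes>\<^bsub>G\<^esub> w = x 3 \<otimes>\<^bsub>G\<^esub> w \<otimes>\<^bsub>G\<^esub> x 3"

definition three_gen_relations :: "('g, 'h) monoid_scheme \<Rightarrow> 'g \<Rightarrow> 'g \<Rightarrow> 'g \<Rightarrow> bool"
  where "three_gen_relations G a s w \<longleftrightarrow>
    (\<forall>i\<in>{2,3,4}. a \<otimes>\<^bsub>G\<^esub> conj_pow G s a i = conj_pow G s a i \<otimes>\<^bsub>G\<^esub> a) \<and>
    s [^]\<^bsub>G\<^esub> (8::nat) = (s \<otimes>\<^bsub>G\<^esub> a) [^]\<^bsub>G\<^esub> (7::nat) \<and>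
    (\<forall>i\<in>{0,1,3,4,5,6}. w \<otimes>\<^bsub>G\<^esub> conj_pow G s a i = conj_pow G s a i \<otimes>\<^bsub>G\<^esub> w) \<and>
    w \<otimes>\<^bsub>G\<^esub> conj_pow G s a 2 \<otimes>\<^bsub>G\<^esub> w = conj_pow G s a 2 \<otimes>\<^bsub>G\<^esub> w \<otimes>\<^bsub>G\<^esub> conj_pow G s a 2"

context group
begin

lemma three_gen_relations_seq_prod:
  assumes "a \<in> carrier G" "s \<in> carrier G" "three_gen_relations G a s w"
  shows "s = seq_prod G (\<lambda>i. conj_pow G s a (int i)) 7"
  using assms pow_Suc_eq_iff_seq_prod[of s a 7] by (simp add: three_gen_relations_def)

lemma three_gen_relations_commute:
  assumes as: "a \<in> carrier G" "s \<in> carrier G" and rel: "three_gen_relations G a s w"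
    and ij: "\<bar>i - j\<bar> \<in> {2..6}"
  shows "conj_pow G s a i \<otimes> conj_pow G s a j = conj_pow G s a j \<otimes> conj_pow G s a i"
proof -
  define c where "c = conj_pow G s a"
  have near: "c i \<otimes> c (i + d) = c (i + d) \<otimes> c i" if "d \<in> {2,3,4}" for i d
  proof -
    have "conj_pow G s a 0 \<otimes> conj_pow G s a d = conj_pow G s a d \<otimes> conj_pow G s a 0"
      using rel that as unfolding three_gen_relations_def by simp blast
    from conj_pow_commute_shift[OF as(2,1) this, of i] show ?thesis
      by (simp add: c_def)
  qed
  have per: "c (i + 8) = c i" for i
    using conj_pow_periodic[OF as(2,1), of 8 7 i] rel
    unfolding c_def three_gen_relations_def by simp
  have ordered: "c i \<otimes> c (i + d) = c (i + d) \<otimes> c i" if "d \<in> {2..6}" for i d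
  proof (cases "d \<le> 4")
    case True
    then have "d \<in> {2,3,4}" using that by auto
    then show ?thesis by (rule near)
  next
    case False
    \<comment> \<open>Going on from \<open>i + d\<close> by \<open>8 - d\<close> steps, which is 3
      or 2, leads to \<open>i + 8\<close>, where the conjugate is again \<open>c i\<close>.\<close>
    then have "8 - d \<in> {2,3,4}" using that by auto
    from near[OF this, of "i + d"] show ?thesis by (simp add: per)
  qed
  show ?thesis
    using ordered[of "j - i" i] ordered[of "i - j" j] ij
    by (cases "i \<le> j") (simp_all add: c_def)
qed

lemma three_gen_relations_braid:
  assumes as: "a \<in> carrier G" "s \<in> carrier G" and rel: "three_gen_relations G a s w"
  shows "conj_pow G s a i \<otimes> conj_pow G s a (i + 1) \<otimes> conj_pow G s a i =
    conj_pow G s a (i + 1) \<otimes> conj_pow G s a i \<otimes> conj_pow G s a (i + 1)"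
proof -
  define c where "c = conj_pow G s a"
  define q where "q = seq_prod G (\<lambda>i. c (2 + int i)) 5"
  have cl: "c i \<in> carrier G" for i
    using as by (simp add: c_def)
  have q: "q \<in> carrier G"
    using cl by (simp add: q_def seq_prod_closed)
  \<comment> \<open>The five factors of \<open>q\<close> have indices 2, ..., 6, so the distances 5
    and 6 obtained from periodicity are needed here.\<close>
  have "c 0 \<otimes> q = q \<otimes> c 0"
    unfolding q_def
  proof (rule seq_prod_commute)
    show "c (2 + int i) \<in> carrier G \<and> c 0 \<otimes> c (2 + int i) = c (2 + int i) \<otimes> c 0" if "i < 5" for i
      using three_gen_relations_commute[OF as rel, of 0 "2 + int i"] that cl by (simp add: c_def)
  qed (rule cl)
  have "s = seq_prod G (\<lambda>i. c (int i)) (2 + 5)"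
    using three_gen_relations_seq_prod[OF as rel] by (simp add: c_def)
  also have "\<dots> = c 0 \<otimes> c 1 \<otimes> q"
    using cl by (subst seq_prod_add) (simp_all add: q_def numeral_2_eq_2)
  finally have s: "s = c 0 \<otimes> c 1 \<otimes> q" .
  have "c 0 \<otimes> c 1 \<otimes> c 0 \<otimes> q = s \<otimes> c 0"
    using \<open>c 0 \<otimes> q = q \<otimes> c 0\<close> s cl q by (simp add: m_assoc)
  also have "\<dots> = c 1 \<otimes> s"
    using conj_pow_step[OF as(2,1), of 0] by (simp add: c_def)
  also have "\<dots> = c 1 \<otimes> c 0 \<otimes> c 1 \<otimes> q"
    using s cl q by (simp add: m_assoc)
  finally have "c 0 \<otimes> c 1 \<otimes> c 0 = c 1 \<otimes> c 0 \<otimes> c 1"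
    using cl q by simp
  \<comment> \<open>The pair (0, 1) is enough, since conjugation by a power of \<open>s\<close>
    carries it to any neighbouring pair.\<close>
  then show ?thesis
    using conj_pow_braid_shift[OF as(2,1), of 0 1 i] by (simp add: c_def)
qed

text \<open>The generator sigma_i corresponds to the conjugate of index i-1, so the branch node 3
  becomes the exponent 2 that is missing from the list 0, 1, 3, 4, 5, 6. Distances between nodes are
  unaffected by the shift.\<close>

lemma three_gen_relations_imp_E8_relations:
  assumes "a \<in> carrier G" "s \<in> carrier G" and rel: "three_gen_relations G a s w"
  shows "E8_relations G (\<lambda>i. conj_pow G s a (int i - 1)) w"
proof -
  have "w \<otimes> conj_pow G s a (int i - 1) = conj_pow G s a (int i - 1) \<otimes> w"
    if "i \<in> {1..7}" "i \<noteq> 3" for i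
  proof -
    have "int i - 1 \<in> {0,1,3,4,5,6}" using that by auto
    then show ?thesis using rel unfolding three_gen_relations_def by blast
  qed
  moreover have "conj_pow G s a (int i - 1) \<otimes> conj_pow G s a (int j - 1) =
      conj_pow G s a (int j - 1) \<otimes> conj_pow G s a (int i - 1)"
    if "i \<in> {1..7}" "j \<in> {1..7}" "\<bar>int i - int j\<bar> > 1" for i j
    using that by (intro three_gen_relations_commute[OF assms]) auto
  moreover have "w \<otimes> conj_pow G s a 2 \<otimes> w = conj_pow G s a 2 \<otimes> w \<otimes> conj_pow G s a 2"
    using rel by (simp add: three_gen_relations_def)
  ultimately show ?thesis
    using three_gen_relations_braid[OF assms, of "int i - 1" for i]
    unfolding E8_relations_def by simp
qed

text \<open>Write the product as \<open>u p q v\<close> around two neighbours \<open>p\<close>,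
  \<open>q\<close>. On multiplication by \<open>p\<close> from the right, \<open>p\<close> passes
  \<open>v\<close>, the braid relation turns \<open>p q p\<close> into \<open>q p q\<close>, and the
  leading \<open>q\<close> passes \<open>u\<close>.\<close>

lemma E8_relations_step:
  assumes x: "\<And>i. i \<in> {1..7} \<Longrightarrow> x i \<in> carrier G" and rel: "E8_relations G x w"
    and i: "i < 6"
  shows "seq_prod G (\<lambda>i. x (i + 1)) 7 \<otimes> x (i + 1) = x (i + 2) \<otimes> seq_prod G (\<lambda>i. x (i + 1)) 7"
proof -
  define u where "u = seq_prod G (\<lambda>j. x (j + 1)) i"
  \<comment> \<open>The factors after \<open>q\<close> run from \<open>x (i + 3)\<close> to
    \<open>x 7\<close>; there are \<open>5 - i\<close> of them, none when
    \<open>i = 5\<close>.\<close>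
  define v where "v = seq_prod G (\<lambda>j. x (i + 2 + j + 1)) (5 - i)"
  define p where "p = x (i + 1)"
  define q where "q = x (i + 2)"
  have cl: "u \<in> carrier G" "v \<in> carrier G" "p \<in> carrier G" "q \<in> carrier G"
    using i by (auto simp: u_def v_def p_def q_def intro!: seq_prod_closed x)
  have pq: "p \<otimes> q \<otimes> p = q \<otimes> p \<otimes> q"
    using rel i by (auto simp: E8_relations_def p_def q_def)
  have comm: "x j \<otimes> x k = x k \<otimes> x j" if "j \<in> {1..7}" "k \<in> {1..7}" "\<bar>int j - int k\<bar> > 1" for j k
    using rel that unfolding E8_relations_def by blast
  have pv: "p \<otimes> v = v \<otimes> p"
    unfolding v_def using i cl by (intro seq_prod_commute) (auto simp: p_def intro!: comm x)
  have qu: "q \<otimes> u = u \<otimes> q"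
    unfolding u_def using i cl by (intro seq_prod_commute) (auto simp: q_def intro!: comm x)
  have "seq_prod G (\<lambda>i. x (i + 1)) 7 = seq_prod G (\<lambda>i. x (i + 1)) (i + 2 + (5 - i))"
    using i by simp
  also have "\<dots> = seq_prod G (\<lambda>i. x (i + 1)) (i + 2) \<otimes> v"
    using i unfolding v_def by (intro seq_prod_add) (auto intro!: x)
  also have "seq_prod G (\<lambda>i. x (i + 1)) (i + 2) = u \<otimes> p \<otimes> q"
    by (simp add: u_def p_def q_def)
  finally have s: "seq_prod G (\<lambda>i. x (i + 1)) 7 = u \<otimes> p \<otimes> q \<otimes> v" .
  have "u \<otimes> p \<otimes> q \<otimes> v \<otimes> p = u \<otimes> (p \<otimes> q \<otimes> p) \<otimes> v"
    using cl by (simp add: m_assoc pv)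
  also have "\<dots> = (u \<otimes> q) \<otimes> p \<otimes> q \<otimes> v"
    using cl by (simp add: m_assoc pq)
  also have "\<dots> = q \<otimes> (u \<otimes> p \<otimes> q \<otimes> v)"
    using cl by (simp add: m_assoc qu[symmetric])
  finally show ?thesis unfolding s by (simp add: p_def q_def)
qed

text \<open>Both sequences begin with \<open>x 1\<close>, and conjugation by the product moves each
  of them one index forward.\<close>

lemma E8_relations_conj_pow:
  assumes x: "\<And>i. i \<in> {1..7} \<Longrightarrow> x i \<in> carrier G" and rel: "E8_relations G x w"
  shows "i < 7 \<Longrightarrow> conj_pow G (seq_prod G (\<lambda>i. x (i + 1)) 7) (x 1) (int i) = x (i + 1)"
proof (induction i)
  case 0
  then show ?case using x by simp
next
  case (Suc i)
  define s where "s = seq_prod G (\<lambda>i. x (i + 1)) 7"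
  have cl: "s \<in> carrier G" "x 1 \<in> carrier G" "x (i + 2) \<in> carrier G"
    using Suc.prems by (auto simp: s_def intro!: seq_prod_closed x)
  have "conj_pow G s (x 1) (1 + int i) \<otimes> s = x (i + 2) \<otimes> s"
    using conj_pow_step[OF cl(1,2), of "int i"] E8_relations_step[OF x rel, of i] Suc
    by (simp add: s_def)
  then show ?case
    using cl by (simp add: s_def)
qed

lemma E8_relations_imp_three_gen_relations:
  assumes x: "\<And>i. i \<in> {1..7} \<Longrightarrow> x i \<in> carrier G" and rel: "E8_relations G x w"
  shows "three_gen_relations G (x 1) (seq_prod G (\<lambda>i. x (i + 1)) 7) w"
proof -
  define s where "s = seq_prod G (\<lambda>i. x (i + 1)) 7"
  have cl: "s \<in> carrier G" "x 1 \<in> carrier G"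
    by (auto simp: s_def intro!: seq_prod_closed x)
  have c: "conj_pow G s (x 1) (int i) = x (i + 1)" if "i < 7" for i
    using E8_relations_conj_pow[OF x rel that] by (simp add: s_def)
  have "seq_prod G (\<lambda>i. conj_pow G s (x 1) (int i)) n = seq_prod G (\<lambda>i. x (i + 1)) n" if "n \<le> 7" for n
    using that
  proof (induction n)
    case (Suc n)
    then show ?case using c[of n] by simp
  qed simp
  \<comment> \<open>Each conjugate is the corresponding \<open>x\<close>, so their product is
    \<open>s\<close> by definition, and the equivalence turns this into the power relation.\<close>
  then have "s [^] Suc 7 = (s \<otimes> x 1) [^] (7::nat)"
    using pow_Suc_eq_iff_seq_prod[OF cl, of 7] by (simp add: s_def)
  then show ?thesis
    using rel c[of 0] c[of 1] c[of 2] c[of 3] c[of 4] c[of 5] c[of 6]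
    unfolding three_gen_relations_def E8_relations_def s_def[symmetric] by simp
qed

end

section \<open>Transfer of relations along homomorphisms\<close>

lemma hom_conj_pow:
  assumes "h \<in> hom G H" "group G" "group H" "s \<in> carrier G" "a \<in> carrier G"
  shows "h (conj_pow G s a i) = conj_pow H (h s) (h a) i"
proof -
  interpret group_hom G H h
    using assms by (simp add: group_hom_def group_hom_axioms_def)
  show ?thesis using assms(4,5) by (simp add: conj_pow_def hom_int_pow)
qed

lemma hom_seq_prod:
  assumes "h \<in> hom G H" "group G" "group H"
  shows "(\<And>i. i < n \<Longrightarrow> x i \<in> carrier G) \<Longrightarrow> h (seq_prod G x n) = seq_prod H (\<lambda>i. h (x i)) n"
proof (induction n)
  case 0
  then show ?case using assms hom_one by simp
next
  case (Suc n)
  then show ?case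
    using assms group.seq_prod_closed[OF assms(2), of n x] by (simp add: hom_mult)
qed

lemma seq_prod_cong: "(\<And>i. i < n \<Longrightarrow> x i = y i) \<Longrightarrow> seq_prod G x n = seq_prod G y n"
  by (induction n) auto

lemma ESigma_mem [simp]: "ESigma i \<in> E8_gens \<longleftrightarrow> i \<in> {1..7}"
  by (auto simp: E8_gens_def)

lemma EOmega_mem [simp]: "EOmega \<in> E8_gens"
  by (simp add: E8_gens_def)

lemma E8_braid_rels_closed:
  "E8_braid_rels \<subseteq> carrier (free_group E8_gens) \<times> carrier (free_group E8_gens)"
proof -
  interpret group "free_group E8_gens" by (rule group_free_group)
  have "free_gen E8_gens (ESigma i) \<in> carrier (free_group E8_gens)" if "i \<in> {1..7}" for i
    using that by (intro free_gen_closed) simp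
  moreover have "free_gen E8_gens EOmega \<in> carrier (free_group E8_gens)"
    by (intro free_gen_closed) simp
  ultimately show ?thesis
    unfolding E8_braid_rels_def Let_def by auto
qed

lemma three_gen_braid_rels_closed:
  "three_gen_braid_rels \<subseteq> carrier (free_group UNIV) \<times> carrier (free_group UNIV)"
proof -
  interpret group "free_group (UNIV :: gen3 set)" by (rule group_free_group)
  show ?thesis
    unfolding three_gen_braid_rels_def Let_def by (auto simp: free_gen_closed)
qed

lemma three_gen_square_rels_closed:
  "three_gen_square_rels \<subseteq> carrier (free_group UNIV) \<times> carrier (free_group UNIV)"
proof -
  interpret group "free_group (UNIV :: gen3 set)" by (rule group_free_group)
  show ?thesis
    unfolding three_gen_square_rels_def Let_def by (auto simp: free_gen_closed)
qed

text \<open>Links syntactic relations with the predicate on elements: from right to left it allows a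
  map out of the presented group to be built, from left to right it reads off the relations that
  hold in an image.\<close>

lemma E8_braid_rels_iff:
  assumes h: "h \<in> hom (free_group E8_gens) G"
    and g: "\<And>x. x \<in> E8_gens \<Longrightarrow> h (free_gen E8_gens x) = g x"
  shows "(\<forall>(l, r)\<in>E8_braid_rels. h l = h r) \<longleftrightarrow> E8_relations G (\<lambda>i. g (ESigma i)) (g EOmega)"
proof -
  interpret group "free_group E8_gens" by (rule group_free_group)
  let ?F = "free_group E8_gens"
  let ?s = "\<lambda>i. free_gen E8_gens (ESigma i)" and ?w = "free_gen E8_gens EOmega"
  have s: "?s i \<in> carrier ?F \<and> h (?s i) = g (ESigma i)" if "i \<in> {1..7}" for i
    using that by (simp add: free_gen_closed g)
  have w: "?w \<in> carrier ?F \<and> h ?w = g EOmega"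
    by (simp add: free_gen_closed g)
  have mult: "h (x \<otimes>\<^bsub>?F\<^esub> y) = h x \<otimes>\<^bsub>G\<^esub> h y" if "x \<in> carrier ?F" "y \<in> carrier ?F" for x y
    using h that by (rule hom_mult)
  \<comment> \<open>Membership in the comprehensions is recast as bounded quantification; with
    \<open>ball_cong_simp\<close> the bounds are then at hand to evaluate \<open>h\<close> at
    \<open>?s i\<close>, which requires \<open>i\<close> between 1 and 7.\<close>
  have 1: "(\<forall>(l, r)\<in>{(?s i \<otimes>\<^bsub>?F\<^esub> ?s j, ?s j \<otimes>\<^bsub>?F\<^esub> ?s i) | i j.
      i \<in> {1..7} \<and> j \<in> {1..7} \<and> \<bar>int i - int j\<bar> > 1}. h l = h r) \<longleftrightarrow>
    (\<forall>i\<in>{1..7}. \<forall>j\<in>{1..7}. \<bar>int i - int j\<bar> > 1 \<longrightarrow>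
      h (?s i \<otimes>\<^bsub>?F\<^esub> ?s j) = h (?s j \<otimes>\<^bsub>?F\<^esub> ?s i))"
    by blast
  have 2: "(\<forall>(l, r)\<in>{(?s i \<otimes>\<^bsub>?F\<^esub> ?s (i + 1) \<otimes>\<^bsub>?F\<^esub> ?s i,
      ?s (i + 1) \<otimes>\<^bsub>?F\<^esub> ?s i \<otimes>\<^bsub>?F\<^esub> ?s (i + 1)) | i. i \<in> {1..6}}. h l = h r) \<longleftrightarrow>
    (\<forall>i\<in>{1..6}. h (?s i \<otimes>\<^bsub>?F\<^esub> ?s (i + 1) \<otimes>\<^bsub>?F\<^esub> ?s i) =
      h (?s (i + 1) \<otimes>\<^bsub>?F\<^esub> ?s i \<otimes>\<^bsub>?F\<^esub> ?s (i + 1)))"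
    by blast
  have 3: "(\<forall>(l, r)\<in>{(?w \<otimes>\<^bsub>?F\<^esub> ?s i, ?s i \<otimes>\<^bsub>?F\<^esub> ?w) | i. i \<in> {1..7} \<and> i \<noteq> 3}. h l = h r) \<longleftrightarrow>
    (\<forall>i\<in>{1..7}. i \<noteq> 3 \<longrightarrow> h (?w \<otimes>\<^bsub>?F\<^esub> ?s i) = h (?s i \<otimes>\<^bsub>?F\<^esub> ?w))"
    by blast
  show ?thesis
    unfolding E8_braid_rels_def Let_def ball_Un 1 2 3 E8_relations_def
    by (simp add: mult s w cong: ball_cong_simp)
qed

lemma three_gen_braid_rels_iff:
  assumes h: "h \<in> hom (free_group UNIV) G" and G: "group G"
  shows "(\<forall>(l, r)\<in>three_gen_braid_rels. h l = h r) \<longleftrightarrow>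
    three_gen_relations G (h (free_gen UNIV Gsigma1)) (h (free_gen UNIV Gsigma)) (h (free_gen UNIV Gomega))"
proof -
  interpret group_hom "free_group (UNIV :: gen3 set)" G h
    using h G group_free_group by (simp add: group_hom_def group_hom_axioms_def)
  let ?F = "free_group (UNIV :: gen3 set)"
  let ?a = "free_gen UNIV Gsigma1" and ?s = "free_gen UNIV Gsigma" and ?w = "free_gen UNIV Gomega"
  let ?c = "conj_pow ?F ?s ?a"
  have cl: "free_gen UNIV x \<in> carrier ?F" for x :: gen3
    by (simp add: free_gen_closed)
  have c: "?c i \<in> carrier ?F" "h (?c i) = conj_pow G (h ?s) (h ?a) i" for i
    using cl hom_conj_pow[OF h group_free_group G] by (simp_all add: G.conj_pow_closed)
  have 1: "(\<forall>(l, r)\<in>{(?a \<otimes>\<^bsub>?F\<^esub> ?c i, ?c i \<otimes>\<^bsub>?F\<^esub> ?a) | i. i \<in> {2,3,4}}. h l = h r) \<longleftrightarrow>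
    (\<forall>i\<in>{2,3,4}. h (?a \<otimes>\<^bsub>?F\<^esub> ?c i) = h (?c i \<otimes>\<^bsub>?F\<^esub> ?a))"
    by blast
  have 2: "(\<forall>(l, r)\<in>{(?w \<otimes>\<^bsub>?F\<^esub> ?c i, ?c i \<otimes>\<^bsub>?F\<^esub> ?w) | i. i \<in> {0,1,3,4,5,6}}. h l = h r) \<longleftrightarrow>
    (\<forall>i\<in>{0,1,3,4,5,6}. h (?w \<otimes>\<^bsub>?F\<^esub> ?c i) = h (?c i \<otimes>\<^bsub>?F\<^esub> ?w))"
    by blast
  show ?thesis
    unfolding three_gen_braid_rels_def Let_def conj_pow_def[symmetric] ball_Un 1 2
      three_gen_relations_def
    by (simp add: cl c hom_nat_pow del: G.conj_pow_0)
qed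

lemma three_gen_square_rels_iff:
  assumes h: "h \<in> hom (free_group UNIV) G" and G: "group G"
  shows "(\<forall>(l, r)\<in>three_gen_square_rels. h l = h r) \<longleftrightarrow>
    h (free_gen UNIV Gsigma1) [^]\<^bsub>G\<^esub> (2::nat) = \<one>\<^bsub>G\<^esub> \<and> h (free_gen UNIV Gomega) [^]\<^bsub>G\<^esub> (2::nat) = \<one>\<^bsub>G\<^esub>"
proof -
  interpret group_hom "free_group (UNIV :: gen3 set)" G h
    using h G group_free_group by (simp add: group_hom_def group_hom_axioms_def)
  show ?thesis
    unfolding three_gen_square_rels_def Let_def by (simp add: free_gen_closed hom_nat_pow)
qed

section \<open>The presentations\<close>

text \<open>The substitution of conjugates for the canonical generators. The Coxeter group also gets
  its map from here, by a further factorization.\<close>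

lemma braid_E8_hom_exists:
  assumes P: "group P" and cl: "a \<in> carrier P" "s \<in> carrier P" "w \<in> carrier P"
    and rel: "three_gen_relations P a s w"
  obtains k where "k \<in> hom braid_E8 P"
    "\<And>i. i \<in> {1..7} \<Longrightarrow> k (braid_E8_gen (ESigma i)) = conj_pow P s a (int i - 1)"
    "k (braid_E8_gen EOmega) = w"
proof -
  interpret P: group P by fact
  define f where "f x = (case x of ESigma i \<Rightarrow> conj_pow P s a (int i - 1) | EOmega \<Rightarrow> w)" for x
  have f: "f \<in> E8_gens \<rightarrow> carrier P"
    using cl by (auto simp: f_def P.conj_pow_closed split: e8_gen.split)
  have "h l = h r" if "h \<in> hom (free_group E8_gens) P"
    "\<And>x. x \<in> E8_gens \<Longrightarrow> h (free_gen E8_gens x) = f x" "(l, r) \<in> E8_braid_rels" for h l r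
    using E8_braid_rels_iff[OF that(1,2)] P.three_gen_relations_imp_E8_relations[OF cl(1,2) rel] that(3)
    by (auto simp: f_def)
  then obtain k where k: "k \<in> hom (presented_group E8_gens E8_braid_rels) P"
    "\<And>x. x \<in> E8_gens \<Longrightarrow> k (presented_gen E8_gens E8_braid_rels x) = f x"
    using presented_group_hom_exists[OF E8_braid_rels_closed P f] by blast
  show thesis
    by (rule that[of k]) (use k in \<open>auto simp: braid_E8_def braid_E8_gen_def f_def\<close>)
qed

text \<open>\<open>seq_prod\<close> begins with the unit and \<open>three_gens\<close> with its
  first factor; absorbing the unit is what calls for that factor to lie in the carrier.\<close>

lemma three_gens_Gsigma:
  assumes "group G" "g (ESigma 1) \<in> carrier G"
  shows "three_gens G g Gsigma = seq_prod G (\<lambda>i. g (ESigma (i + 1))) 7"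
proof -
  interpret group G by fact
  show ?thesis using assms(2) by (simp add: eval_nat_numeral)
qed

text \<open>\<open>T\<close> is the set of additional relations: empty for the braid group, the squares
  for the Coxeter group.\<close>

lemma three_gens_presentation:
  assumes G: "group G" and g: "g \<in> E8_gens \<rightarrow> carrier G"
    and rel: "E8_relations G (\<lambda>i. g (ESigma i)) (g EOmega)"
    and gen: "generate G (g ` E8_gens) = carrier G"
    and T: "T \<subseteq> carrier (free_group UNIV) \<times> carrier (free_group UNIV)"
      "\<And>h l r. \<lbrakk>h \<in> hom (free_group UNIV) G; \<And>x. h (free_gen UNIV x) = three_gens G g x; (l, r) \<in> T\<rbrakk>
        \<Longrightarrow> h l = h r"
    and ext: "\<And>P p. \<lbrakk>P = presented_group UNIV (three_gen_braid_rels \<union> T);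
        p = presented_gen UNIV (three_gen_braid_rels \<union> T); group P; range p \<subseteq> carrier P;
        three_gen_relations P (p Gsigma1) (p Gsigma) (p Gomega);
        \<exists>q \<in> hom (free_group UNIV) P. (\<forall>x. q (free_gen UNIV x) = p x) \<and> (\<forall>(l, r)\<in>T. q l = q r)\<rbrakk> \<Longrightarrow>
      \<exists>k \<in> hom G P.
        (\<forall>i\<in>{1..7}. k (g (ESigma i)) = conj_pow P (p Gsigma) (p Gsigma1) (int i - 1)) \<and>
        k (g EOmega) = p Gomega"
  shows "has_presentation G UNIV (three_gens G g) (three_gen_braid_rels \<union> T)"
proof -
  interpret G: group G by fact
  define R where "R = three_gen_braid_rels \<union> T"
  define P where "P = presented_group UNIV R"
  define p where "p = presented_gen UNIV R"
  have R: "R \<subseteq> carrier (free_group UNIV) \<times> carrier (free_group UNIV)"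
    using T(1) three_gen_braid_rels_closed by (simp add: R_def)
  have grpP: "group P"
    unfolding P_def by (rule group_presented_group[OF R])
  then interpret P: group P .
  have p: "p x \<in> carrier P" for x
    unfolding p_def P_def by (intro presented_gen_closed[OF R]) simp
  \<comment> \<open>The quotient map sends the free generators to \<open>p\<close> and identifies
    the two sides of each relation, so all the relations can be read off in \<open>P\<close> through
    it.\<close>
  define q where "q = rel_class (free_group UNIV) R"
  have q: "q \<in> hom (free_group UNIV) P"
    unfolding q_def P_def presented_group_def by (rule rel_class_hom[OF group_free_group R])
  have qp: "q (free_gen UNIV x) = p x" for x
    by (simp add: q_def p_def presented_gen_def)
  have qR: "\<forall>(l, r)\<in>R. q l = q r"
    using rel_class_eq[OF group_free_group R] by (auto simp: q_def)
  have relP: "three_gen_relations P (p Gsigma1) (p Gsigma) (p Gomega)"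
    using three_gen_braid_rels_iff[OF q grpP] qR by (simp add: R_def qp)
  have "\<exists>q \<in> hom (free_group UNIV) P. (\<forall>x. q (free_gen UNIV x) = p x) \<and> (\<forall>(l, r)\<in>T. q l = q r)"
    using q qp qR unfolding R_def by (intro bexI[of _ q]) blast+
  \<comment> \<open>This is where the two groups need different arguments: \<open>ext\<close>
    supplies the map out of \<open>G\<close>, and it is told through \<open>q\<close> that the
    relations in \<open>T\<close> hold in \<open>P\<close>.\<close>
  then have "\<exists>k \<in> hom G P.
      (\<forall>i\<in>{1..7}. k (g (ESigma i)) = conj_pow P (p Gsigma) (p Gsigma1) (int i - 1)) \<and>
      k (g EOmega) = p Gomega"
    using p by (intro ext[OF P_def[unfolded R_def] p_def[unfolded R_def] grpP _ relP]) auto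
  then obtain k where k: "k \<in> hom G P"
    "\<And>i. i \<in> {1..7} \<Longrightarrow> k (g (ESigma i)) = conj_pow P (p Gsigma) (p Gsigma1) (int i - 1)"
    "k (g EOmega) = p Gomega"
    by blast
  have gS: "g (ESigma i) \<in> carrier G" if "i \<in> {1..7}" for i
    using g that by (auto simp: Pi_iff)
  have gO: "g EOmega \<in> carrier G"
    using g by (auto simp: Pi_iff)
  have sigma: "three_gens G g Gsigma = seq_prod G (\<lambda>i. g (ESigma (i + 1))) 7"
    using gS[of 1] by (intro three_gens_Gsigma[OF G]) simp
  have tg: "three_gens G g x \<in> carrier G" for x
  proof (cases x)
    case Gsigma
    then show ?thesis unfolding Gsigma sigma by (auto intro!: G.seq_prod_closed gS)
  qed (use gS[of 1] gO in auto)
  have kt: "k (three_gens G g x) = p x" for x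
  proof (cases x)
    case Gsigma1
    then show ?thesis using k(2)[of 1] p by simp
  next
    case Gsigma
    have "k (three_gens G g Gsigma) = seq_prod P (\<lambda>i. k (g (ESigma (i + 1)))) 7"
      unfolding sigma by (rule hom_seq_prod[OF k(1) G grpP]) (auto intro!: gS)
    also have "\<dots> = seq_prod P (\<lambda>i. conj_pow P (p Gsigma) (p Gsigma1) (int i)) 7"
      by (rule seq_prod_cong) (simp add: k(2))
    \<comment> \<open>The power relation enters here: it identifies the product of the conjugates of
      indices 0, ..., 6 with \<open>p Gsigma\<close> itself.\<close>
    also have "\<dots> = p Gsigma"
      using P.three_gen_relations_seq_prod[OF p p relP] by simp
    finally show ?thesis using Gsigma by simp
  next
    case Gomega
    then show ?thesis using k(3) by simp
  qed
  have "has_presentation G UNIV (three_gens G g) R"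
  proof (rule has_presentationI[OF G R])
    show "three_gens G g \<in> UNIV \<rightarrow> carrier G"
      using tg by simp
    show "h l = h r" if h: "h \<in> hom (free_group UNIV) G"
      "\<And>x. x \<in> UNIV \<Longrightarrow> h (free_gen UNIV x) = three_gens G g x" and lr: "(l, r) \<in> R" for h l r
    proof -
      have "three_gen_relations G (g (ESigma 1)) (three_gens G g Gsigma) (g EOmega)"
        unfolding sigma by (rule G.E8_relations_imp_three_gen_relations[OF gS rel])
      then have "\<forall>(l, r)\<in>three_gen_braid_rels. h l = h r"
        using three_gen_braid_rels_iff[OF h(1) G] h(2) by (simp del: three_gens.simps(2))
      then show ?thesis
        using T(2)[OF h(1)] h(2) lr by (auto simp: R_def)
    qed
    show "g ` E8_gens \<subseteq> carrier G"
      using g by auto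
    show "generate G (g ` E8_gens) = carrier G"
      by (rule gen)
    show "k \<in> hom G (presented_group UNIV R)"
      using k(1) by (simp add: P_def)
    show "k (three_gens G g x) = presented_gen UNIV R x" for x
      using kt by (simp add: p_def)
    show "h (k y) = y" if h: "h \<in> hom (presented_group UNIV R) G"
      "\<And>x. x \<in> UNIV \<Longrightarrow> h (presented_gen UNIV R x) = three_gens G g x" and y: "y \<in> g ` E8_gens" for h y
    proof -
      have hP: "h \<in> hom P G" and hp: "h (p x) = three_gens G g x" for x
        using h by (simp_all add: P_def p_def)
      have "h (k (g (ESigma i))) = g (ESigma i)" if i: "i \<in> {1..7}" for i
      proof -
        have "h (k (g (ESigma i))) = conj_pow G (h (p Gsigma)) (h (p Gsigma1)) (int i - 1)"
          using k(2)[OF i] hom_conj_pow[OF hP grpP G p p] by simp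
        \<comment> \<open>Since \<open>i\<close> is at least 1, the integer \<open>int i - 1\<close>
          is the image of the natural number \<open>i - 1\<close>, the form in which the conjugates
          have been computed.\<close>
        also have "\<dots> = conj_pow G (seq_prod G (\<lambda>i. g (ESigma (i + 1))) 7) (g (ESigma 1)) (int (i - 1))"
          unfolding hp sigma using i by (simp add: of_nat_diff)
        also have "\<dots> = g (ESigma (i - 1 + 1))"
          using i by (intro G.E8_relations_conj_pow[OF gS rel]) auto
        finally show ?thesis using i by simp
      qed
      moreover have "h (k (g EOmega)) = g EOmega"
        using k(3) hp by simp
      ultimately show ?thesis
        using y by (auto simp: E8_gens_def)
    qed
  qed
  then show ?thesis by (simp add: R_def)
qed

section \<open>Generators and relations in the braid group and in its Coxeter quotient\<close>

lemma group_braid_E8: "group braid_E8"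
  unfolding braid_E8_def by (rule group_presented_group[OF E8_braid_rels_closed])

lemma braid_E8_gen_closed: "x \<in> E8_gens \<Longrightarrow> braid_E8_gen x \<in> carrier braid_E8"
  unfolding braid_E8_def braid_E8_gen_def by (rule presented_gen_closed[OF E8_braid_rels_closed])

lemma braid_E8_generate: "generate braid_E8 (braid_E8_gen ` E8_gens) = carrier braid_E8"
  unfolding braid_E8_def braid_E8_gen_def by (rule presented_group_generate[OF E8_braid_rels_closed])

text \<open>Composing \<open>q\<close> with the projection from the free group reduces this to
  \<open>E8_braid_rels_iff\<close>. The identity as \<open>q\<close> gives the braid group, the
  projection onto \<open>coxeter_E8\<close> the Coxeter group.\<close>

lemma E8_relations_braid_E8_quotient:
  assumes "q \<in> hom braid_E8 G"
  shows "E8_relations G (\<lambda>i. q (braid_E8_gen (ESigma i))) (q (braid_E8_gen EOmega))"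
proof -
  have "rel_class (free_group E8_gens) E8_braid_rels \<in> hom (free_group E8_gens) braid_E8"
    unfolding braid_E8_def presented_group_def
    by (rule rel_class_hom[OF group_free_group E8_braid_rels_closed])
  then have h: "q \<circ> rel_class (free_group E8_gens) E8_braid_rels \<in> hom (free_group E8_gens) G"
    using assms by (rule hom_compose)
  show ?thesis
    using E8_braid_rels_iff[OF h, of "\<lambda>x. q (braid_E8_gen x)"]
      rel_class_eq[OF group_free_group E8_braid_rels_closed]
    by (fastforce simp: braid_E8_gen_def presented_gen_def)
qed

lemma E8_square_rels_closed: "E8_square_rels \<subseteq> carrier braid_E8 \<times> carrier braid_E8"
proof -
  interpret group braid_E8 by (rule group_braid_E8)
  show ?thesis by (auto simp: E8_square_rels_def braid_E8_gen_closed)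
qed

lemma group_coxeter_E8: "group coxeter_E8"
  unfolding coxeter_E8_def by (rule group_rel_quotient[OF group_braid_E8 E8_square_rels_closed])

lemma coxeter_E8_proj: "rel_class braid_E8 E8_square_rels \<in> hom braid_E8 coxeter_E8"
  unfolding coxeter_E8_def by (rule rel_class_hom[OF group_braid_E8 E8_square_rels_closed])

lemma coxeter_E8_gen_closed: "x \<in> E8_gens \<Longrightarrow> coxeter_E8_gen x \<in> carrier coxeter_E8"
  unfolding coxeter_E8_gen_def using hom_in_carrier[OF coxeter_E8_proj] braid_E8_gen_closed by blast

lemma coxeter_E8_generate: "generate coxeter_E8 (coxeter_E8_gen ` E8_gens) = carrier coxeter_E8"
proof -
  have "coxeter_E8_gen ` E8_gens = rel_class braid_E8 E8_square_rels ` braid_E8_gen ` E8_gens"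
    by (auto simp: coxeter_E8_gen_def)
  moreover have "braid_E8_gen ` E8_gens \<subseteq> carrier braid_E8"
    using braid_E8_gen_closed by blast
  ultimately show ?thesis
    unfolding coxeter_E8_def
    using rel_quotient_generate[OF group_braid_E8 E8_square_rels_closed _ braid_E8_generate] by simp
qed

lemma coxeter_E8_gen_square:
  assumes "x \<in> E8_gens"
  shows "coxeter_E8_gen x [^]\<^bsub>coxeter_E8\<^esub> (2::nat) = \<one>\<^bsub>coxeter_E8\<^esub>"
proof -
  interpret group coxeter_E8 by (rule group_coxeter_E8)
  have "rel_class braid_E8 E8_square_rels (braid_E8_gen x \<otimes>\<^bsub>braid_E8\<^esub> braid_E8_gen x) =
      rel_class braid_E8 E8_square_rels \<one>\<^bsub>braid_E8\<^esub>"
    using assms by (intro rel_class_eq[OF group_braid_E8 E8_square_rels_closed])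
      (auto simp: E8_square_rels_def)
  then have "coxeter_E8_gen x \<otimes>\<^bsub>coxeter_E8\<^esub> coxeter_E8_gen x = \<one>\<^bsub>coxeter_E8\<^esub>"
    using hom_mult[OF coxeter_E8_proj] hom_one[OF coxeter_E8_proj group_braid_E8 group_coxeter_E8]
      braid_E8_gen_closed[OF assms]
    by (simp add: coxeter_E8_gen_def)
  then show ?thesis
    using coxeter_E8_gen_closed[OF assms] by (simp add: numeral_2_eq_2)
qed

text \<open>Only sigma_1 and omega are required to have trivial square, whereas the Coxeter group
  imposes this on all eight generators; sigma_2, ..., sigma_7 inherit it as conjugates of
  sigma_1.\<close>

lemma (in group) conj_pow_square:
  assumes "s \<in> carrier G" "a \<in> carrier G" "a [^] (2::nat) = \<one>"
  shows "conj_pow G s a i \<otimes> conj_pow G s a i = \<one>"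
proof -
  have "a \<otimes> a = \<one>"
    using assms by (simp add: numeral_2_eq_2)
  moreover have "conj_pow G s a i \<otimes> conj_pow G s a i =
      s [^] i \<otimes> a \<otimes> (s [^] (- i) \<otimes> s [^] i) \<otimes> a \<otimes> s [^] (- i)"
    using assms by (simp add: conj_pow_def m_assoc)
  ultimately show ?thesis
    using assms by (simp add: int_pow_mult[symmetric] m_assoc[of "s [^] i"])
qed

lemma braid_E8_presentation:
  "has_presentation braid_E8 UNIV (three_gens braid_E8 braid_E8_gen) three_gen_braid_rels"
proof -
  have "has_presentation braid_E8 UNIV (three_gens braid_E8 braid_E8_gen) (three_gen_braid_rels \<union> {})"
  proof (rule three_gens_presentation[OF group_braid_E8 _ _ braid_E8_generate])
    show "braid_E8_gen \<in> E8_gens \<rightarrow> carrier braid_E8"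
      using braid_E8_gen_closed by blast
    show "E8_relations braid_E8 (\<lambda>i. braid_E8_gen (ESigma i)) (braid_E8_gen EOmega)"
      by (rule E8_relations_braid_E8_quotient[of "\<lambda>x. x"]) (auto intro: homI)
  next
    fix P :: "gen3 word set set monoid" and p :: "gen3 \<Rightarrow> gen3 word set set"
    assume P: "group P" and p: "range p \<subseteq> carrier P"
      and rel: "three_gen_relations P (p Gsigma1) (p Gsigma) (p Gomega)"
    have "p x \<in> carrier P" for x
      using p by auto
    from braid_E8_hom_exists[OF P this this this rel] show "\<exists>k \<in> hom braid_E8 P.
        (\<forall>i\<in>{1..7}. k (braid_E8_gen (ESigma i)) = conj_pow P (p Gsigma) (p Gsigma1) (int i - 1)) \<and>
        k (braid_E8_gen EOmega) = p Gomega"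
      by metis
  qed auto
  then show ?thesis by simp
qed

text \<open>The map out of \<open>coxeter_E8\<close> is built in two stages: first on
  \<open>braid_E8\<close>, where only the braid relations matter, then on the quotient, once the
  squares of all generators are seen to be sent to 1.\<close>

lemma coxeter_E8_presentation:
  "has_presentation coxeter_E8 UNIV (three_gens coxeter_E8 coxeter_E8_gen)
    (three_gen_braid_rels \<union> three_gen_square_rels)"
proof (rule three_gens_presentation[OF group_coxeter_E8 _ _ coxeter_E8_generate])
  show "E8_relations coxeter_E8 (\<lambda>i. coxeter_E8_gen (ESigma i)) (coxeter_E8_gen EOmega)"
    unfolding coxeter_E8_gen_def by (rule E8_relations_braid_E8_quotient[OF coxeter_E8_proj])
next
  fix h l r
  assume h: "h \<in> hom (free_group UNIV) coxeter_E8"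
    "\<And>x. h (free_gen UNIV x) = three_gens coxeter_E8 coxeter_E8_gen x"
    and lr: "(l, r) \<in> three_gen_square_rels"
  have "\<forall>(l, r)\<in>three_gen_square_rels. h l = h r"
    using three_gen_square_rels_iff[OF h(1) group_coxeter_E8] by (simp add: h(2) coxeter_E8_gen_square)
  then show "h l = h r" using lr by blast
next
  fix P :: "gen3 word set set monoid" and p :: "gen3 \<Rightarrow> gen3 word set set"
  assume P: "group P" and p: "range p \<subseteq> carrier P"
    and rel: "three_gen_relations P (p Gsigma1) (p Gsigma) (p Gomega)"
    and "\<exists>q \<in> hom (free_group UNIV) P. (\<forall>x. q (free_gen UNIV x) = p x) \<and>
      (\<forall>(l, r)\<in>three_gen_square_rels. q l = q r)"
  then have sq: "p Gsigma1 [^]\<^bsub>P\<^esub> (2::nat) = \<one>\<^bsub>P\<^esub>" "p Gomega [^]\<^bsub>P\<^esub> (2::nat) = \<one>\<^bsub>P\<^esub>"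
    using three_gen_square_rels_iff[OF _ P] by auto
  interpret P: group P by fact
  have pc: "p x \<in> carrier P" for x
    using p by auto
  obtain k where k: "k \<in> hom braid_E8 P"
    "\<And>i. i \<in> {1..7} \<Longrightarrow> k (braid_E8_gen (ESigma i)) = conj_pow P (p Gsigma) (p Gsigma1) (int i - 1)"
    "k (braid_E8_gen EOmega) = p Gomega"
    using braid_E8_hom_exists[OF P pc pc pc rel] by blast
  have "k (braid_E8_gen x) \<otimes>\<^bsub>P\<^esub> k (braid_E8_gen x) = \<one>\<^bsub>P\<^esub>" if "x \<in> E8_gens" for x
    using that sq k(2,3) P.conj_pow_square[OF pc pc] pc
    by (cases x) (auto simp: numeral_2_eq_2)
  then have "k l = k r" if "(l, r) \<in> E8_square_rels" for l r
    using that hom_mult[OF k(1)] hom_one[OF k(1) group_braid_E8 P] braid_E8_gen_closed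
    by (auto simp: E8_square_rels_def)
  then obtain k' where k': "k' \<in> hom coxeter_E8 P"
    "\<And>x. x \<in> carrier braid_E8 \<Longrightarrow> k' (rel_class braid_E8 E8_square_rels x) = k x"
    unfolding coxeter_E8_def
    using rel_quotient_hom_exists[OF group_braid_E8 E8_square_rels_closed P k(1)] by blast
  then show "\<exists>k \<in> hom coxeter_E8 P.
      (\<forall>i\<in>{1..7}. k (coxeter_E8_gen (ESigma i)) = conj_pow P (p Gsigma) (p Gsigma1) (int i - 1)) \<and>
      k (coxeter_E8_gen EOmega) = p Gomega"
    using k(2,3) by (intro bexI[of _ k']) (auto simp: coxeter_E8_gen_def braid_E8_gen_closed)
qed (auto simp: coxeter_E8_gen_closed three_gen_square_rels_closed)

theorem mainTheorem6:
  shows "has_presentation braid_E8 UNIV (three_gens braid_E8 braid_E8_gen) three_gen_braid_rels \<and>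
    has_presentation coxeter_E8 UNIV (three_gens coxeter_E8 coxeter_E8_gen)
      (three_gen_braid_rels \<union> three_gen_square_rels)"
  using braid_E8_presentation coxeter_E8_presentation by blast

end
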